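(* Let $C$ be a positive definite $p\times p$ correlation matrix, $\lambda\ge0$ and $\alpha<1$, and let \[ F(R,D)=-\log\det(R)-2(1-\alpha)\log\det(D) +\operatorname{tr}( C DRD)+ \lambda \|R\|_{1,\mathrm{off}},\qquad (R,D)\in\mathrm{S}_{++}^{(1)}\times\mathrm{Diag}_+ . \] Then for each coordinate-wise minimizer $(\hat R,\hat D)$ of $F$, the matrix $\hat K=\hat D\hat R\hat D$ satisfies \[ \| \hat{K}^{-1}-C\|_\infty \leq \frac{(\lambda p +|\alpha|)p^2}{(1-\alpha)\lambda_{\min}(C)}. \]
   Context: $\mathrm{S}_{++}^{(1)}$ is the set of real symmetric positive definite $p\times p$ matrices with unit diagonal; $\mathrm{Diag}_+$ is the set of $p\times p$ diagonal matrices with strictly positive diagonal entries. A correlation matrix is a symmetric positive semidefinite matrix with unit diagonal. $\|R\|_{1,\mathrm{off}}=\sum_{i\ne j}|R_{ij}|$, $\|A\|_\infty=\max_{i,j}|A_{ij}|$, and $\lambda_{\min}$ is the smallest eigenvalue. A coordinate-wise minimizer of $F$ is a point $(\hat R,\hat D)$ of the domain such that $F(\hat R,D)\ge F(\hat R,\hat D)\le F(R,\hat D)$ for every $R\in\mathrm{S}_{++}^{(1)}$ and $D\in\mathrm{Diag}_+$. *)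

theory Defs
  imports "HOL-Analysis.Analysis"
begin

definition pos_def_mat :: "real^'n^'n \<Rightarrow> bool" where
  "pos_def_mat A \<longleftrightarrow> transpose A = A \<and> (\<forall>x. x \<noteq> 0 \<longrightarrow> 0 < x \<bullet> (A *v x))"

definition pos_semidef_mat :: "real^'n^'n \<Rightarrow> bool" where
  "pos_semidef_mat A \<longleftrightarrow> transpose A = A \<and> (\<forall>x. 0 \<le> x \<bullet> (A *v x))"

definition correlation_mat :: "real^'n^'n \<Rightarrow> bool" where
  "correlation_mat A \<longleftrightarrow> pos_semidef_mat A \<and> (\<forall>i. A $ i $ i = 1)"

definition pos_def_unit_diag :: "(real^'n^'n) set" where
  "pos_def_unit_diag = {R. pos_def_mat R \<and> (\<forall>i. R $ i $ i = 1)}"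

definition pos_diag :: "(real^'n^'n) set" where
  "pos_diag = {D. (\<forall>i j. i \<noteq> j \<longrightarrow> D $ i $ j = 0) \<and> (\<forall>i. 0 < D $ i $ i)}"

definition norm_1_off :: "real^'n^'n \<Rightarrow> real" where
  "norm_1_off A = (\<Sum>i\<in>UNIV. \<Sum>j\<in>UNIV - {i}. \<bar>A $ i $ j\<bar>)"

text \<open>The entrywise maximum, not the operator norm induced by the sup norm.\<close>

definition norm_max :: "real^'n^'n \<Rightarrow> real" where
  "norm_max A = Max {\<bar>A $ i $ j\<bar> | i j. True}"

definition eigenvalue :: "real^'n^'n \<Rightarrow> real \<Rightarrow> bool" where
  "eigenvalue A \<mu> \<longleftrightarrow> (\<exists>v. v \<noteq> 0 \<and> A *v v = \<mu> *\<^sub>R v)"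

text \<open>Only meaningful for matrices with at least one real eigenvalue, e.g.\ symmetric ones.\<close>

definition lambda_min :: "real^'n^'n \<Rightarrow> real" where
  "lambda_min A = Min {\<mu>. eigenvalue A \<mu>}"

definition objective ::
  "real^'n^'n \<Rightarrow> real \<Rightarrow> real \<Rightarrow> real^'n^'n \<Rightarrow> real^'n^'n \<Rightarrow> real" where
  "objective C lam \<alpha> R D =
     - ln (det R) - 2 * (1 - \<alpha>) * ln (det D) + trace (C ** D ** R ** D) + lam * norm_1_off R"

definition coordinatewise_minimizer ::
  "'a set \<Rightarrow> 'b set \<Rightarrow> ('a \<Rightarrow> 'b \<Rightarrow> real) \<Rightarrow> 'a \<Rightarrow> 'b \<Rightarrow> bool" where
  "coordinatewise_minimizer S T F r d \<longleftrightarrow>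
     r \<in> S \<and> d \<in> T \<and> (\<forall>d'\<in>T. F r d \<le> F r d') \<and> (\<forall>r'\<in>S. F r d \<le> F r' d)"

end

theory Submission
  imports Defs
begin

text \<open>
  Stationarity in \<open>D\<close> says that all diagonal entries of \<open>C D R D\<close> equal \<open>1 - \<alpha>\<close>. Stationarity in
  \<open>R\<close> says that the off-diagonal entries of \<open>G = R\<^sup>-\<^sup>1 - D C D\<close> are at most \<open>lam\<close> in absolute value;
  the unit diagonal of \<open>R\<close> leaves those on the diagonal free, but the diagonal of \<open>G R\<close> is
  constantly \<open>\<alpha>\<close>, which bounds them by \<open>lam * p + \<bar>\<alpha>\<bar>\<close>. As \<open>K\<^sup>-\<^sup>1 - C = D\<^sup>-\<^sup>1 G D\<^sup>-\<^sup>1\<close>, it remains to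
  bound the entries \<open>d\<close> of \<open>D\<close> from below. By the Schur product theorem the Hadamard product \<open>W\<close> of
  \<open>C\<close> and \<open>R\<close> has least eigenvalue at least that of \<open>C\<close>, so \<open>d \<bullet> W d = p (1 - \<alpha>)\<close> bounds the norm
  of \<open>d\<close> from above, and then \<open>1 - \<alpha> = d\<^sub>k (W d)\<^sub>k \<le> d\<^sub>k (\<Sum>\<^sub>j d\<^sub>j)\<close> bounds \<open>d\<^sub>k\<close> from below.
\<close>

section \<open>Quadratic forms and the Schur product theorem\<close>

lemma symmetric_entry:
  assumes "transpose A = A"
  shows "A $ i $ j = A $ j $ i"
  by (metis assms transpose_def vec_lambda_beta)

lemma inner_matrix_vector_sym:
  fixes A :: "real^'n^'n"
  assumes "transpose A = A"
  shows "x \<bullet> (A *v y) = y \<bullet> (A *v x)"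
  by (metis assms dot_lmul_matrix inner_commute transpose_matrix_vector)

lemma inner_matrix_vector_eq_sum:
  fixes A :: "real^'n^'n"
  shows "x \<bullet> (A *v y) = (\<Sum>i\<in>UNIV. \<Sum>j\<in>UNIV. A $ i $ j * (x $ i * y $ j))"
  by (simp add: inner_vec_def matrix_vector_mult_def sum_distrib_left mult_ac)

lemma inner_axis_matrix_axis:
  fixes A :: "real^'n^'n"
  shows "axis i 1 \<bullet> (A *v axis j 1) = A $ i $ j"
  by (simp add: inner_axis' matrix_vector_mult_basis column_def)

lemma inner_axis_matrix:
  fixes A :: "real^'n^'n"
  shows "axis i 1 \<bullet> (A *v x) = (A *v x) $ i"
  by (simp add: inner_axis')

lemma pos_def_imp_pos_semidef: "pos_def_mat A \<Longrightarrow> pos_semidef_mat A"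
  unfolding pos_def_mat_def pos_semidef_mat_def
  by (metis inner_zero_left less_eq_real_def)

lemma quadratic_form_add_scaled:
  fixes A :: "real^'n^'n"
  assumes "transpose A = A"
  shows "(x + t *\<^sub>R y) \<bullet> (A *v (x + t *\<^sub>R y))
    = x \<bullet> (A *v x) + 2 * t * (x \<bullet> (A *v y)) + t\<^sup>2 * (y \<bullet> (A *v y))"
  using inner_matrix_vector_sym[OF assms, of y x]
  by (simp add: algebra_simps power2_eq_square matrix_vector_mult_scaleR)

text \<open>The form at \<open>x + t *\<^sub>R y\<close> is a polynomial in \<open>t\<close> that is
  never negative. As \<open>A\<close> may be singular, its leading coefficient \<open>c\<close> can
  vanish without \<open>y\<close> being zero, so this case is separate.\<close>

lemma pos_semidef_cauchy_schwarz:
  assumes "pos_semidef_mat A"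
  shows "(x \<bullet> (A *v y))\<^sup>2 \<le> (x \<bullet> (A *v x)) * (y \<bullet> (A *v y))"
proof -
  define a b c where "a = x \<bullet> (A *v x)" and "b = x \<bullet> (A *v y)" and "c = y \<bullet> (A *v y)"
  have sym: "transpose A = A" and nonneg: "\<And>z. 0 \<le> z \<bullet> (A *v z)"
    using assms by (auto simp: pos_semidef_mat_def)
  have quad: "0 \<le> a + 2 * t * b + t\<^sup>2 * c" for t
    using nonneg[of "x + t *\<^sub>R y"]
    by (simp add: quadratic_form_add_scaled[OF sym] a_def b_def c_def)
  have "b\<^sup>2 \<le> a * c"
  proof (cases "c = 0")
    case True
    have "b = 0"
    proof (rule ccontr)
      assume "b \<noteq> 0"
      \<comment> \<open>For \<open>c = 0\<close> the polynomial is affine; the chosen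
        \<open>t\<close> gives it the value -1.\<close>
      then show False
        using quad[of "- (a + 1) / (2 * b)"] True by (simp add: field_simps)
    qed
    then show ?thesis using True by simp
  next
    case False
    then have "c > 0" using nonneg[of y] by (simp add: c_def)
    \<comment> \<open>\<open>- b / c\<close> is the minimum point of the polynomial, with value
      \<open>a - b\<^sup>2 / c\<close>.\<close>
    then show ?thesis
      using quad[of "- b / c"] by (simp add: field_simps power2_eq_square)
  qed
  then show ?thesis by (simp add: a_def b_def c_def)
qed

lemma correlation_entry_le_1:
  assumes "pos_semidef_mat A" and "\<And>i. A $ i $ i = 1"
  shows "\<bar>A $ i $ j\<bar> \<le> 1"
  using pos_semidef_cauchy_schwarz[OF assms(1), of "axis i 1" "axis j 1"] assms(2)
  by (simp add: inner_axis_matrix_axis abs_square_le_1)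

text \<open>
  Each induction step splits off from \<open>B\<close> the rank-one matrix built from its row \<open>k\<close>; the rest is a
  Schur complement, again positive semidefinite. This avoids the spectral theorem.
\<close>

lemma sum_prod_pos_semidef_nonneg_aux:
  fixes A B :: "real^'n^'n"
  assumes A: "pos_semidef_mat A" and "finite S" and "pos_semidef_mat B"
    and "\<And>i j. i \<notin> S \<Longrightarrow> B $ i $ j = 0"
  shows "0 \<le> (\<Sum>i\<in>UNIV. \<Sum>j\<in>UNIV. A $ i $ j * B $ i $ j)"
  using assms(2-)
proof (induction S arbitrary: B)
  case empty
  then show ?case by simp
next
  case (insert k S)
  have sym: "transpose B = B" and nonneg: "\<And>z. 0 \<le> z \<bullet> (B *v z)"
    using insert.prems by (auto simp: pos_semidef_mat_def)
  have symB: "B $ i $ j = B $ j $ i" for i j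
    by (rule symmetric_entry[OF sym])
  define b where "b = B $ k"
  define B' where "B' = (\<chi> i j. B $ i $ j - b $ i * b $ j / b $ k)"
  \<comment> \<open>If \<open>b $ k = 0\<close>, then \<open>b = 0\<close> by Cauchy-Schwarz, and \<open>B' = B\<close> because of \<open>x / 0 = 0\<close>.\<close>
  have cs: "(b \<bullet> x)\<^sup>2 \<le> b $ k * (x \<bullet> (B *v x))" for x
    using pos_semidef_cauchy_schwarz[OF insert.prems(1), of "axis k 1" x]
    by (simp add: inner_axis_matrix_axis inner_axis_matrix b_def matrix_vector_mul_component inner_axis)
  have bk: "0 \<le> b $ k"
    using nonneg[of "axis k 1"] by (simp add: inner_axis_matrix_axis b_def)
  have b0: "b $ i = 0" if "b $ k = 0" for i
    using cs[of "axis i 1"] that by (simp add: inner_axis)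
  have form: "x \<bullet> (B' *v x) = x \<bullet> (B *v x) - (b \<bullet> x)\<^sup>2 / b $ k" for x
    unfolding inner_matrix_vector_eq_sum B'_def
    by (simp add: inner_vec_def power2_eq_square sum_product sum_divide_distrib sum_subtractf
        algebra_simps)
  have "pos_semidef_mat B'"
    unfolding pos_semidef_mat_def
  proof (intro conjI allI)
    show "transpose B' = B'"
      by (simp add: transpose_def B'_def vec_eq_iff symB mult.commute)
    show "0 \<le> x \<bullet> (B' *v x)" for x
      using cs[of x] bk nonneg[of x]
      by (cases "b $ k = 0") (auto simp: form field_simps)
  qed
  \<comment> \<open>Splitting off the rank-one part clears row \<open>k\<close> and creates no
    entries in rows that were already zero, so the support shrinks to \<open>S\<close>.\<close>
  moreover have "B' $ i $ j = 0" if "i \<notin> S" for i j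
  proof (cases "i = k")
    case True
    then show ?thesis using b0[of j] by (auto simp: B'_def b_def)
  next
    case False
    then have B0: "B $ i $ j = 0" for j using insert.prems(2)[of i] that by simp
    then have "b $ i = 0" by (metis b_def symB)
    with B0[of j] show ?thesis by (simp add: B'_def)
  qed
  ultimately have IH: "0 \<le> (\<Sum>i\<in>UNIV. \<Sum>j\<in>UNIV. A $ i $ j * B' $ i $ j)"
    by (rule insert.IH)
  \<comment> \<open>Summed against \<open>A\<close>, the rank-one part becomes the quadratic form of
    \<open>A\<close> at \<open>b\<close>, divided by the pivot.\<close>
  have "(\<Sum>i\<in>UNIV. \<Sum>j\<in>UNIV. A $ i $ j * B $ i $ j)
      = (\<Sum>i\<in>UNIV. \<Sum>j\<in>UNIV. A $ i $ j * B' $ i $ j) + (b \<bullet> (A *v b)) / b $ k"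
    unfolding inner_matrix_vector_eq_sum B'_def
    by (simp add: sum_divide_distrib sum.distrib[symmetric] algebra_simps)
  moreover have "0 \<le> (b \<bullet> (A *v b)) / b $ k"
    using A bk by (simp add: pos_semidef_mat_def)
  ultimately show ?case using IH by linarith
qed

text \<open>This is the Hadamard product tested on the all-ones vector only; any other vector can be
  absorbed into \<open>B\<close> by a diagonal scaling.\<close>

lemma sum_prod_pos_semidef_nonneg:
  fixes A B :: "real^'n^'n"
  assumes "pos_semidef_mat A" and "pos_semidef_mat B"
  shows "0 \<le> (\<Sum>i\<in>UNIV. \<Sum>j\<in>UNIV. A $ i $ j * B $ i $ j)"
  using sum_prod_pos_semidef_nonneg_aux[of A UNIV B] assms by simp

section \<open>The least eigenvalue of a symmetric matrix\<close>

text \<open>Eigenvectors for distinct eigenvalues are orthogonal, hence independent. Finiteness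
  gives the \<open>Min\<close> in \<open>lambda_min\<close> its meaning.\<close>

lemma symmetric_finite_eigenvalues:
  fixes A :: "real^'n^'n"
  assumes sym: "transpose A = A"
  shows "finite {\<mu>. eigenvalue A \<mu>}"
proof -
  define v where "v \<mu> = (SOME v. v \<noteq> 0 \<and> A *v v = \<mu> *\<^sub>R v)" for \<mu>
  have v: "v \<mu> \<noteq> 0 \<and> A *v v \<mu> = \<mu> *\<^sub>R v \<mu>" if "eigenvalue A \<mu>" for \<mu>
    using that unfolding eigenvalue_def v_def by (rule someI_ex)
  have orth: "v \<mu> \<bullet> v \<nu> = 0" if "eigenvalue A \<mu>" "eigenvalue A \<nu>" "\<mu> \<noteq> \<nu>" for \<mu> \<nu>
    using inner_matrix_vector_sym[OF sym, of "v \<mu>" "v \<nu>"] v[OF that(1)] v[OF that(2)] that(3)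
    by (simp add: inner_commute)
  have inj: "inj_on v {\<mu>. eigenvalue A \<mu>}"
    using orth v by (fastforce intro!: inj_onI)
  have "independent (v ` {\<mu>. eigenvalue A \<mu>})"
    using orth v by (intro pairwise_orthogonal_independent)
      (auto simp: pairwise_def orthogonal_def)
  then have "finite (v ` {\<mu>. eigenvalue A \<mu>})"
    by (rule independent_imp_finite)
  then show ?thesis using inj by (simp add: finite_image_iff)
qed

text \<open>\<open>m\<close> is the minimum of the quadratic form on the unit sphere, attained at
  some \<open>v\<close> by compactness. Then \<open>A - m *\<^sub>R mat 1\<close> is positive
  semidefinite and its form vanishes at \<open>v\<close>, which makes \<open>v\<close> an
  eigenvector.\<close>

lemma symmetric_least_eigenvalue:
  fixes A :: "real^'n^'n"
  assumes sym: "transpose A = A"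
  obtains m where "eigenvalue A m" and "\<And>x. m * (x \<bullet> x) \<le> x \<bullet> (A *v x)"
proof -
  have "\<exists>v\<in>sphere 0 1. \<forall>x\<in>sphere 0 1. v \<bullet> (A *v v) \<le> x \<bullet> (A *v x)"
    by (intro continuous_attains_inf continuous_intros) auto
  then obtain v where v: "norm v = 1"
    and min: "\<And>x. norm x = 1 \<Longrightarrow> v \<bullet> (A *v v) \<le> x \<bullet> (A *v x)"
    by auto
  define m where "m = v \<bullet> (A *v v)"
  have ge: "m * (x \<bullet> x) \<le> x \<bullet> (A *v x)" for x
  proof (cases "x = 0")
    case False
    have "m \<le> (x /\<^sub>R norm x) \<bullet> (A *v (x /\<^sub>R norm x))"
      unfolding m_def by (rule min) (use False in simp)
    also have "\<dots> = (x \<bullet> (A *v x)) / (x \<bullet> x)"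
      by (simp add: matrix_vector_mult_scaleR power2_norm_eq_inner[symmetric] power2_eq_square
          divide_inverse)
    finally show ?thesis using False by (simp add: field_simps)
  qed simp
  define B where "B = A - m *\<^sub>R mat 1"
  have B: "B *v x = A *v x - m *\<^sub>R x" for x
    by (simp add: B_def matrix_vector_mult_diff_rdistrib scaleR_matrix_vector_assoc[symmetric])
  have "transpose B = B"
    using sym by (auto simp: B_def transpose_def vec_eq_iff mat_def)
  then have "pos_semidef_mat B"
    using ge by (simp add: pos_semidef_mat_def B inner_diff_right)
  moreover have "v \<bullet> (B *v v) = 0"
    using v by (simp add: B inner_diff_right m_def power2_norm_eq_inner[symmetric])
  \<comment> \<open>Cauchy-Schwarz for the form of \<open>B\<close>, applied to
    \<open>B *v v\<close> and \<open>v\<close>, bounds the square of the left-hand side by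
    0.\<close>
  ultimately have "(B *v v) \<bullet> (B *v v) = 0"
    using pos_semidef_cauchy_schwarz[of B "B *v v" v] by simp
  then have "A *v v = m *\<^sub>R v" by (simp add: B)
  moreover have "v \<noteq> 0" using v by auto
  ultimately show thesis using that ge unfolding eigenvalue_def by blast
qed

lemma lambda_min_le_rayleigh:
  assumes "transpose A = A"
  shows "lambda_min A * (x \<bullet> x) \<le> x \<bullet> (A *v x)"
proof -
  obtain m where m: "eigenvalue A m" and ge: "\<And>x. m * (x \<bullet> x) \<le> x \<bullet> (A *v x)"
    using symmetric_least_eigenvalue[OF assms] by blast
  have "lambda_min A \<le> m"
    unfolding lambda_min_def
    using m symmetric_finite_eigenvalues[OF assms] by (intro Min_le) auto
  then have "lambda_min A * (x \<bullet> x) \<le> m * (x \<bullet> x)"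
    by (simp add: mult_right_mono)
  then show ?thesis using ge[of x] by linarith
qed

lemma lambda_min_pos:
  assumes "pos_def_mat A"
  shows "0 < lambda_min A"
proof -
  have sym: "transpose A = A" using assms by (simp add: pos_def_mat_def)
  obtain m where "eigenvalue A m" using symmetric_least_eigenvalue[OF sym] by blast
  then have "lambda_min A \<in> {\<mu>. eigenvalue A \<mu>}"
    unfolding lambda_min_def
    using symmetric_finite_eigenvalues[OF sym] by (intro Min_in) auto
  then obtain v where v: "v \<noteq> 0" "A *v v = lambda_min A *\<^sub>R v"
    by (auto simp: eigenvalue_def)
  then have "0 < lambda_min A * (v \<bullet> v)"
    using assms by (metis inner_scaleR_right pos_def_mat_def)
  then show ?thesis using inner_ge_zero[of v] by (auto simp: zero_less_mult_iff)
qed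

section \<open>Determinants of positive definite matrices and the derivative of log det\<close>

lemma pos_def_invertible:
  assumes "pos_def_mat A"
  shows "invertible A"
proof -
  have "x = 0" if "A *v x = 0" for x
    using assms that unfolding pos_def_mat_def by (metis inner_zero_right less_irrefl)
  then show ?thesis
    unfolding invertible_left_inverse matrix_left_invertible_ker by blast
qed

text \<open>The segment from the identity to \<open>A\<close> consists of positive definite, hence
  invertible, matrices, so the determinant cannot change sign along it.\<close>

lemma pos_def_det_pos:
  fixes A :: "real^'n^'n"
  assumes A: "pos_def_mat A"
  shows "0 < det A"
proof (rule ccontr)
  assume neg: "\<not> 0 < det A"
  define P where "P t = (1 - t) *\<^sub>R mat 1 + t *\<^sub>R A" for t :: real
  have pd: "pos_def_mat (P t)" if "0 \<le> t" "t \<le> 1" for t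
    unfolding pos_def_mat_def
  proof (intro conjI allI impI)
    show "transpose (P t) = P t"
      using A by (auto simp: P_def transpose_def vec_eq_iff mat_def pos_def_mat_def)
    fix x :: "real^'n" assume "x \<noteq> 0"
    then have "0 < x \<bullet> x" "0 < x \<bullet> (A *v x)" using A by (auto simp: pos_def_mat_def)
    then have "0 < (1 - t) * (x \<bullet> x) + t * (x \<bullet> (A *v x))"
      using that by (cases "t = 0") (auto intro!: add_nonneg_pos)
    then show "0 < x \<bullet> (P t *v x)"
      by (simp add: P_def matrix_vector_mult_add_rdistrib scaleR_matrix_vector_assoc[symmetric]
          inner_add_right)
  qed
  have "continuous_on {0..1} (\<lambda>t. det (P t))"
    unfolding det_def P_def by (intro continuous_intros)
  moreover have "det (P 1) \<le> 0" "0 \<le> det (P 0)"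
    using neg by (auto simp: P_def)
  ultimately obtain t where "0 \<le> t" "t \<le> 1" "det (P t) = 0"
    using IVT2'[of "\<lambda>t. det (P t)" 1 0 0] by auto
  then show False
    using pos_def_invertible[OF pd] by (simp add: invertible_det_nz)
qed

text \<open>In the Leibniz expansion a permutation other than \<open>id\<close> moves at least two
  indices. Its product then has two factors vanishing at 0 and contributes nothing to first
  order.\<close>

lemma det_mat_1_plus_has_derivative:
  fixes M :: "real^'n^'n"
  shows "((\<lambda>t. det (mat 1 + t *\<^sub>R M)) has_real_derivative trace M) (at 0)"
proof -
  define f where "f p i t = (mat 1 + t *\<^sub>R M) $ i $ p i" for p :: "'n \<Rightarrow> 'n" and i t
  define f' where "f' p = (\<Sum>i\<in>UNIV. M $ i $ p i * (\<Prod>j\<in>UNIV - {i}. f p j 0))" for p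
  have "((\<lambda>t. f p i t) has_real_derivative M $ i $ p i) (at 0)" for p i
    unfolding f_def by (auto intro!: derivative_eq_intros)
  then have prod: "((\<lambda>t. \<Prod>i\<in>UNIV. f p i t) has_real_derivative f' p) (at 0)" for p
    unfolding f'_def by (intro has_field_derivative_prod)
  have f'_id: "f' id = trace M"
    by (simp add: f'_def f_def trace_def mat_def)
  have f'_0: "f' p = 0" if p: "p permutes UNIV" "p \<noteq> id" for p
  proof -
    have "(\<Prod>j\<in>UNIV - {i}. f p j 0) = 0" for i
    proof -
      \<comment> \<open>Both \<open>k\<close> and \<open>p k\<close> are moved by \<open>p\<close>,
        and at least one of them differs from \<open>i\<close>.\<close>
      obtain k where k: "p k \<noteq> k" using p(2) by (auto simp: fun_eq_iff)
      then have "p (p k) \<noteq> p k" using permutes_inj[OF p(1)] by (auto dest: injD)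
      with k obtain j where "j \<noteq> i" "p j \<noteq> j" by metis
      then show ?thesis
        by (intro prod_zero bexI[of _ j]) (auto simp: f_def mat_def)
    qed
    then show ?thesis by (simp only: f'_def mult_zero_right sum.neutral_const)
  qed
  have "((\<lambda>t. det (mat 1 + t *\<^sub>R M)) has_real_derivative
      (\<Sum>p | p permutes UNIV. of_int (sign p) * f' p)) (at 0)"
    unfolding det_def f_def[symmetric] by (intro DERIV_sum DERIV_cmult prod)
  also have "(\<Sum>p | p permutes UNIV. of_int (sign p) * f' p)
      = (\<Sum>p\<in>{id}. of_int (sign p) * f' p)"
    by (rule sum.mono_neutral_right) (auto simp: f'_0 permutes_id finite_permutations)
  finally show ?thesis by (simp add: f'_id sign_id)
qed

text \<open>Factoring out \<open>R\<close> leaves the determinant of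
  \<open>mat 1 + t *\<^sub>R (Q ** H)\<close>, so the derivative at the identity suffices.\<close>

lemma ln_det_has_derivative:
  fixes R H Q :: "real^'n^'n"
  assumes "0 < det R" and RQ: "R ** Q = mat 1"
  shows "((\<lambda>t. ln (det (R + t *\<^sub>R H))) has_real_derivative trace (Q ** H)) (at 0)"
proof -
  have "R + t *\<^sub>R H = R ** (mat 1 + t *\<^sub>R (Q ** H))" for t
    by (simp add: matrix_add_ldistrib RQ matrix_mul_assoc matrix_scalar_ac flip: scalar_matrix_assoc)
  then have "det (R + t *\<^sub>R H) = det R * det (mat 1 + t *\<^sub>R (Q ** H))" for t
    by (simp add: det_mul)
  then have "((\<lambda>t. det (R + t *\<^sub>R H)) has_real_derivative det R * trace (Q ** H)) (at 0)"
    using DERIV_cmult[OF det_mat_1_plus_has_derivative] by simp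
  from DERIV_chain2[OF DERIV_ln this] show ?thesis
    using assms(1) by (simp add: field_simps)
qed

section \<open>Tools for varying \<open>R\<close> and \<open>D\<close>\<close>

text \<open>Serves as the first-order condition for the penalty, which is not differentiable at zero
  entries: the one-sided slopes \<open>s + L\<close> and \<open>s - L\<close> of
  \<open>g t + L * \<bar>t\<bar>\<close> cannot point downhill from 0.\<close>

lemma derivative_bound_at_kink:
  fixes g :: "real \<Rightarrow> real"
  assumes g: "(g has_real_derivative s) (at 0)" and "0 < e"
    and ge: "\<And>t. \<bar>t\<bar> < e \<Longrightarrow> g 0 \<le> g t + L * \<bar>t\<bar>"
  shows "\<bar>s\<bar> \<le> L"
proof -
  have "- L \<le> s"
  proof (rule ccontr)
    assume "\<not> - L \<le> s"
    moreover have "((\<lambda>t. g t + L * t) has_real_derivative s + L) (at 0)"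
      by (auto intro!: derivative_eq_intros g)
    ultimately obtain d where d: "0 < d" "\<And>h. 0 < h \<Longrightarrow> h < d \<Longrightarrow> g h + L * h < g 0"
      using DERIV_neg_dec_right[of "\<lambda>t. g t + L * t" "s + L" 0] by auto
    define h where "h = min d e / 2"
    have "0 < h" "h < d" "h < e" using d(1) \<open>0 < e\<close> by (auto simp: h_def min_def)
    then show False
      using d(2)[of h] ge[of h] by simp
  qed
  moreover have "s \<le> L"
  proof (rule ccontr)
    assume "\<not> s \<le> L"
    moreover have "((\<lambda>t. g t - L * t) has_real_derivative s - L) (at 0)"
      by (auto intro!: derivative_eq_intros g)
    ultimately obtain d where d: "0 < d" "\<And>h. 0 < h \<Longrightarrow> h < d \<Longrightarrow> g (- h) + L * h < g 0"
      using DERIV_pos_inc_left[of "\<lambda>t. g t - L * t" "s - L" 0] by auto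
    define h where "h = min d e / 2"
    have "0 < h" "h < d" "h < e" using d(1) \<open>0 < e\<close> by (auto simp: h_def min_def)
    then show False
      using d(2)[of h] ge[of "- h"] by simp
  qed
  ultimately show ?thesis by linarith
qed


lemma matrix_inv_eqI:
  fixes A B :: "real^'n^'n"
  assumes "A ** B = mat 1"
  shows "matrix_inv A = B"
proof -
  have "B ** A = mat 1" using assms by (simp add: matrix_left_right_inverse)
  with assms have "\<exists>B. A ** B = mat 1 \<and> B ** A = mat 1" by blast
  then have *: "A ** matrix_inv A = mat 1 \<and> matrix_inv A ** A = mat 1"
    unfolding matrix_inv_def by (rule someI_ex)
  have "matrix_inv A = matrix_inv A ** (A ** B)" by (simp add: assms)
  also have "\<dots> = B" using * by (simp add: matrix_mul_assoc)
  finally show ?thesis .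
qed

text \<open>If \<open>m\<close> bounds the form of \<open>R\<close> from below and \<open>B\<close>
  bounds the operator norm of \<open>H\<close>, every \<open>t\<close> with
  \<open>\<bar>t\<bar> < m / B\<close> is small enough.\<close>

lemma pos_def_perturbation:
  fixes R H :: "real^'n^'n"
  assumes R: "pos_def_mat R" and H: "transpose H = H"
  obtains e where "0 < e" and "\<And>t. \<bar>t\<bar> < e \<Longrightarrow> pos_def_mat (R + t *\<^sub>R H)"
proof -
  obtain B where B: "0 < B" "\<And>x. norm (H *v x) \<le> norm x * B"
    using bounded_linear.pos_bounded[OF matrix_vector_mul_bounded_linear[of H]] by blast
  define m where "m = lambda_min R"
  have m: "0 < m" "\<And>x. m * (x \<bullet> x) \<le> x \<bullet> (R *v x)"
    using lambda_min_pos[OF R] lambda_min_le_rayleigh R by (auto simp: m_def pos_def_mat_def)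
  have "pos_def_mat (R + t *\<^sub>R H)" if t: "\<bar>t\<bar> < m / B" for t
    unfolding pos_def_mat_def
  proof (intro conjI allI impI)
    show "transpose (R + t *\<^sub>R H) = R + t *\<^sub>R H"
      using R H by (simp add: pos_def_mat_def transpose_def vec_eq_iff)
    fix x :: "real^'n" assume x: "x \<noteq> 0"
    have "\<bar>x \<bullet> (H *v x)\<bar> \<le> norm x * norm (H *v x)"
      by (rule Cauchy_Schwarz_ineq2)
    also have "\<dots> \<le> norm x * (norm x * B)"
      using B(2) by (intro mult_left_mono) auto
    also have "\<dots> = B * (x \<bullet> x)"
      by (simp add: power2_norm_eq_inner[symmetric] power2_eq_square)
    finally have "\<bar>t * (x \<bullet> (H *v x))\<bar> \<le> \<bar>t\<bar> * (B * (x \<bullet> x))"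
      by (simp add: abs_mult mult_left_mono)
    also have "\<dots> < m * (x \<bullet> x)"
      using t B(1) x by (simp add: field_simps)
    finally have "0 < x \<bullet> (R *v x) + t * (x \<bullet> (H *v x))"
      using m(2)[of x] by linarith
    then show "0 < x \<bullet> ((R + t *\<^sub>R H) *v x)"
      by (simp add: matrix_vector_mult_add_rdistrib scaleR_matrix_vector_assoc[symmetric]
          inner_add_right)
  qed
  moreover have "0 < m / B" using m(1) B(1) by simp
  ultimately show thesis using that by blast
qed

lemma pos_diag_mult_left: "D \<in> pos_diag \<Longrightarrow> (D ** A) $ i $ j = D $ i $ i * A $ i $ j"
proof -
  assume D: "D \<in> pos_diag"
  have "(D ** A) $ i $ j = (\<Sum>k\<in>UNIV. if k = i then D $ i $ i * A $ i $ j else 0)"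
    unfolding matrix_matrix_mult_def vec_lambda_beta
    using D by (intro sum.cong) (auto simp: pos_diag_def)
  then show ?thesis by simp
qed

lemma pos_diag_mult_right: "D \<in> pos_diag \<Longrightarrow> (A ** D) $ i $ j = A $ i $ j * D $ j $ j"
proof -
  assume D: "D \<in> pos_diag"
  have "(A ** D) $ i $ j = (\<Sum>k\<in>UNIV. if k = j then A $ i $ j * D $ j $ j else 0)"
    unfolding matrix_matrix_mult_def vec_lambda_beta
    using D by (intro sum.cong) (auto simp: pos_diag_def)
  then show ?thesis by simp
qed

lemma trace_mult: "trace (A ** B) = (\<Sum>i\<in>UNIV. \<Sum>j\<in>UNIV. A $ i $ j * B $ j $ i)"
  by (simp add: trace_def matrix_matrix_mult_def)

text \<open>Shows the trace term to be linear in \<open>R\<close> and, for fixed \<open>R\<close>, a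
  quadratic form in the diagonal of \<open>D\<close>; each stationarity condition uses one of these
  readings.\<close>

lemma trace_pos_diag_sandwich:
  fixes C D R :: "real^'n^'n"
  assumes "D \<in> pos_diag"
  shows "trace (C ** D ** R ** D)
    = (\<Sum>i\<in>UNIV. \<Sum>j\<in>UNIV. D $ i $ i * C $ i $ j * D $ j $ j * R $ j $ i)"
proof -
  have "trace (C ** D ** R ** D) = trace (D ** C ** D ** R)"
    by (metis matrix_mul_assoc trace_mul_sym)
  then show ?thesis
    by (simp add: trace_mult pos_diag_mult_left[OF assms] pos_diag_mult_right[OF assms])
qed

section \<open>Stationarity in \<open>D\<close> and in \<open>R\<close>\<close>

text \<open>Varying only the \<open>k\<close>-th diagonal entry of \<open>D\<close> gives a
  differentiable function of one variable with a local minimum at 0; its derivative there is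
  zero.\<close>

lemma minimizer_in_D_stationary:
  fixes C R D :: "real^'n^'n"
  assumes symC: "transpose C = C" and symR: "transpose R = R" and D: "D \<in> pos_diag"
    and min: "\<And>D'. D' \<in> pos_diag \<Longrightarrow> objective C lam \<alpha> R D \<le> objective C lam \<alpha> R D'"
  shows "D $ k $ k * (\<Sum>j\<in>UNIV. C $ k $ j * R $ k $ j * D $ j $ j) = 1 - \<alpha>"
proof -
  define d :: "real^'n" where "d = (\<chi> i. D $ i $ i)"
  define W :: "real^'n^'n" where "W = (\<chi> i j. C $ i $ j * R $ i $ j)"
  have sym: "C $ i $ j = C $ j $ i" "R $ i $ j = R $ j $ i" for i j
    by (rule symmetric_entry[OF symC], rule symmetric_entry[OF symR])
  have symW: "transpose W = W"
    by (simp add: W_def transpose_def vec_eq_iff sym[symmetric])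
  have dpos: "0 < d $ i" for i using D by (simp add: d_def pos_diag_def)
  define E :: "real \<Rightarrow> real^'n^'n" where
    "E t = (\<chi> i j. if i = j then (d + t *\<^sub>R axis k 1) $ i else 0)" for t
  \<comment> \<open>The part of the objective at \<open>E t\<close> that depends on
    \<open>t\<close>; the two are compared only for \<open>\<bar>t\<bar> < d $ k\<close>, where
    \<open>E t\<close> stays in \<open>pos_diag\<close>.\<close>
  define \<phi> where "\<phi> t = - 2 * (1 - \<alpha>) * (\<Sum>i\<in>UNIV. ln (d $ i + t * axis k 1 $ i))
    + (d \<bullet> (W *v d) + 2 * t * (W *v d) $ k + t\<^sup>2 * W $ k $ k)" for t
  have E0: "E 0 = D"
    using D by (auto simp: E_def d_def vec_eq_iff pos_diag_def)
  have E: "E t \<in> pos_diag" if "\<bar>t\<bar> < d $ k" for t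
    using dpos that by (auto simp: E_def pos_diag_def axis_def)
  have obj: "objective C lam \<alpha> R (E t) = \<phi> t + (lam * norm_1_off R - ln (det R))"
    if t: "\<bar>t\<bar> < d $ k" for t
  proof -
    let ?e = "d + t *\<^sub>R axis k 1"
    have Eii: "E t $ i $ i = ?e $ i" for i by (simp add: E_def)
    have "det (E t) = (\<Prod>i\<in>UNIV. ?e $ i)"
      by (subst det_diagonal) (auto simp: E_def)
    moreover have "?e $ i \<noteq> 0" for i
      using E[OF t] Eii[of i] by (metis (mono_tags, lifting) mem_Collect_eq pos_diag_def less_irrefl)
    ultimately have "ln (det (E t)) = (\<Sum>i\<in>UNIV. ln (?e $ i))"
      by (simp add: ln_prod)
    moreover have "trace (C ** E t ** R ** E t) = ?e \<bullet> (W *v ?e)"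
      unfolding trace_pos_diag_sandwich[OF E[OF t]] inner_matrix_vector_eq_sum Eii W_def
      by (auto intro!: sum.cong simp: sym(2))
    moreover have "?e \<bullet> (W *v ?e) = d \<bullet> (W *v d) + 2 * t * (W *v d) $ k + t\<^sup>2 * W $ k $ k"
      by (simp add: quadratic_form_add_scaled[OF symW] inner_axis_matrix_axis
          inner_matrix_vector_sym[OF symW, of d "axis k 1"]) (simp add: inner_axis_matrix)
    ultimately show ?thesis by (simp add: objective_def \<phi>_def algebra_simps)
  qed
  have "(\<phi> has_real_derivative
      - 2 * (1 - \<alpha>) * (\<Sum>i\<in>UNIV. axis k 1 $ i / d $ i) + 2 * (W *v d) $ k) (at 0)"
    unfolding \<phi>_def
    using dpos by (auto intro!: derivative_eq_intros simp: less_imp_neq[THEN not_sym] dpos)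
  moreover have "(\<Sum>i\<in>UNIV. axis k 1 $ i / d $ i) = (\<Sum>i\<in>UNIV. if i = k then 1 / d $ k else 0)"
    by (intro sum.cong) (auto simp: axis_def)
  ultimately have der: "(\<phi> has_real_derivative - 2 * (1 - \<alpha>) / d $ k + 2 * (W *v d) $ k) (at 0)"
    by simp
  have "\<forall>t. \<bar>0 - t\<bar> < d $ k \<longrightarrow> \<phi> 0 \<le> \<phi> t"
    using min[OF E] obj[of 0] obj dpos[of k] by (auto simp: E0)
  from DERIV_local_min[OF der dpos this] have "d $ k * (W *v d) $ k = 1 - \<alpha>"
    using dpos[of k] by (simp add: field_simps)
  then show ?thesis by (simp add: d_def W_def matrix_vector_mult_def)
qed

text \<open>Moving the entries at \<open>(i, j)\<close> and \<open>(j, i)\<close> together by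
  \<open>t\<close> changes log det and trace differentiably and raises the penalty by at most
  \<open>2 * lam * \<bar>t\<bar>\<close>.\<close>

lemma minimizer_in_R_stationary:
  fixes C R D :: "real^'n^'n"
  assumes symC: "transpose C = C" and R: "R \<in> pos_def_unit_diag" and D: "D \<in> pos_diag"
    and lam: "0 \<le> lam"
    and min: "\<And>R'. R' \<in> pos_def_unit_diag \<Longrightarrow> objective C lam \<alpha> R D \<le> objective C lam \<alpha> R' D"
    and RQ: "R ** Q = mat 1" and symQ: "transpose Q = Q" and ij: "i \<noteq> j"
  shows "\<bar>Q $ i $ j - D $ i $ i * C $ i $ j * D $ j $ j\<bar> \<le> lam"
proof -
  have pd: "pos_def_mat R" and diag: "\<And>i. R $ i $ i = 1"
    using R by (auto simp: pos_def_unit_diag_def)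
  \<comment> \<open>The symmetric direction with ones at \<open>(i, j)\<close> and
    \<open>(j, i)\<close>; since \<open>i \<noteq> j\<close>, it leaves the unit diagonal of
    \<open>R\<close> alone.\<close>
  define H :: "real^'n^'n" where
    "H = (\<chi> a b. (if a = i then if b = j then 1 else 0 else 0)
      + (if a = j then if b = i then 1 else 0 else 0))"
  have sumH: "(\<Sum>a\<in>UNIV. \<Sum>b\<in>UNIV. f a b * H $ a $ b) = f i j + f j i" for f :: "'n \<Rightarrow> 'n \<Rightarrow> real"
  proof -
    have "f a b * H $ a $ b = (if b = j then if a = i then f a b else 0 else 0)
        + (if b = i then if a = j then f a b else 0 else 0)" for a b
      by (simp add: H_def)
    then show ?thesis by (simp add: sum.distrib)
  qed
  have symH: "H $ a $ b = H $ b $ a" for a b by (auto simp: H_def)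
  have trH: "transpose H = H" by (simp add: transpose_def vec_eq_iff symH[symmetric])
  obtain e where e: "0 < e" "\<And>t. \<bar>t\<bar> < e \<Longrightarrow> pos_def_mat (R + t *\<^sub>R H)"
    using pos_def_perturbation[OF pd trH] by blast
  have mem: "R + t *\<^sub>R H \<in> pos_def_unit_diag" if "\<bar>t\<bar> < e" for t
    using e(2)[OF that] ij diag by (auto simp: pos_def_unit_diag_def H_def)
  define s where "s = trace (C ** D ** H ** D)"
  have sym: "C $ a $ b = C $ b $ a" "Q $ a $ b = Q $ b $ a" for a b
    by (rule symmetric_entry[OF symC], rule symmetric_entry[OF symQ])
  have s: "s = 2 * (D $ i $ i * C $ i $ j * D $ j $ j)"
    unfolding s_def trace_pos_diag_sandwich[OF D]
    using sumH[of "\<lambda>a b. D $ a $ a * C $ a $ b * D $ b $ b"] by (simp add: symH sym(1)[of j i])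
  have "norm_1_off H = (\<Sum>a\<in>UNIV. \<Sum>b\<in>UNIV. (if a = b then 0 else 1) * H $ a $ b)"
    unfolding norm_1_off_def
  proof (rule sum.cong[OF refl])
    fix a
    show "(\<Sum>b\<in>UNIV - {a}. \<bar>H $ a $ b\<bar>) = (\<Sum>b\<in>UNIV. (if a = b then 0 else 1) * H $ a $ b)"
      by (rule sum.mono_neutral_cong_left) (auto simp: H_def)
  qed
  then have normH: "norm_1_off H = 2" using sumH[of "\<lambda>a b. if a = b then 0 else 1"] ij by simp
  have norm: "norm_1_off (R + t *\<^sub>R H) \<le> norm_1_off R + \<bar>t\<bar> * 2" for t
  proof -
    have "norm_1_off (R + t *\<^sub>R H) \<le> norm_1_off R + \<bar>t\<bar> * norm_1_off H"
      unfolding norm_1_off_def sum_distrib_left sum.distrib[symmetric]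
      by (intro sum_mono) (simp add: abs_mult[symmetric] abs_triangle_ineq)
    then show ?thesis by (simp add: normH)
  qed
  \<comment> \<open>Only the differentiable terms that vary with \<open>t\<close>; the penalty
    enters through the slack \<open>2 * lam * \<bar>t\<bar>\<close>.\<close>
  define g where "g t = - ln (det (R + t *\<^sub>R H)) + s * t" for t
  have "trace (Q ** H) = 2 * Q $ i $ j"
    unfolding trace_mult using sumH[of "\<lambda>a b. Q $ a $ b"] by (simp add: symH sym(2)[of j i])
  with ln_det_has_derivative[OF pos_def_det_pos[OF pd] RQ, of H]
  have "((\<lambda>t. ln (det (R + t *\<^sub>R H))) has_real_derivative 2 * Q $ i $ j) (at 0)"
    by simp
  then have der: "(g has_real_derivative - (2 * Q $ i $ j) + s) (at 0)"
    unfolding g_def by (intro DERIV_add DERIV_minus DERIV_cmult_Id)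
  have "\<bar>- (2 * Q $ i $ j) + s\<bar> \<le> 2 * lam"
  proof (rule derivative_bound_at_kink[OF der e(1)])
    fix t assume t: "\<bar>t\<bar> < e"
    have "trace (C ** D ** (R + t *\<^sub>R H) ** D) = trace (C ** D ** R ** D) + s * t"
      unfolding s_def trace_pos_diag_sandwich[OF D]
      by (simp add: sum.distrib sum_distrib_left algebra_simps)
    moreover have "lam * norm_1_off (R + t *\<^sub>R H) \<le> lam * norm_1_off R + 2 * lam * \<bar>t\<bar>"
      using mult_left_mono[OF norm[of t] lam] by (simp add: algebra_simps)
    ultimately show "g 0 \<le> g t + 2 * lam * \<bar>t\<bar>"
      using min[OF mem[OF t]] by (simp add: objective_def g_def)
  qed
  then show ?thesis unfolding s by linarith
qed

section \<open>The Hadamard product of \<open>C\<close> and \<open>R\<close>\<close>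

text \<open>\<open>C - lambda_min C *\<^sub>R mat 1\<close> and \<open>R\<close> scaled by
  \<open>d\<close> on both sides are positive semidefinite, so their entrywise products have a
  nonnegative sum. The subtracted identity meets only the diagonal, where \<open>R\<close> is 1, and
  yields the sum of squares.\<close>

lemma hadamard_lower_bound:
  fixes C R :: "real^'n^'n"
  assumes C: "pos_def_mat C" and R: "pos_semidef_mat R" "\<And>i. R $ i $ i = 1"
  shows "lambda_min C * (\<Sum>i\<in>UNIV. (d $ i)\<^sup>2)
    \<le> (\<Sum>i\<in>UNIV. \<Sum>j\<in>UNIV. C $ i $ j * (R $ i $ j * (d $ i * d $ j)))"
proof -
  define A where "A = C - lambda_min C *\<^sub>R mat 1"
  define K :: "real^'n^'n" where "K = (\<chi> i j. R $ i $ j * (d $ i * d $ j))"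
  have symC: "transpose C = C" using C by (simp add: pos_def_mat_def)
  have "transpose A = A"
    using symC by (auto simp: A_def transpose_def vec_eq_iff mat_def)
  then have "pos_semidef_mat A"
    using lambda_min_le_rayleigh[OF symC]
    by (simp add: pos_semidef_mat_def A_def matrix_vector_mult_diff_rdistrib
        scaleR_matrix_vector_assoc[symmetric] inner_diff_right)
  moreover have "pos_semidef_mat K"
    unfolding pos_semidef_mat_def
  proof (intro conjI allI)
    show "transpose K = K"
      using R(1) by (simp add: K_def pos_semidef_mat_def transpose_def vec_eq_iff mult.commute)
    fix x
    have "x \<bullet> (K *v x) = (\<chi> i. d $ i * x $ i) \<bullet> (R *v (\<chi> i. d $ i * x $ i))"
      unfolding inner_matrix_vector_eq_sum K_def by (simp add: mult_ac)
    then show "0 \<le> x \<bullet> (K *v x)" using R(1) by (simp add: pos_semidef_mat_def)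
  qed
  ultimately have "0 \<le> (\<Sum>i\<in>UNIV. \<Sum>j\<in>UNIV. A $ i $ j * K $ i $ j)"
    by (rule sum_prod_pos_semidef_nonneg)
  also have "\<dots> = (\<Sum>i\<in>UNIV. \<Sum>j\<in>UNIV. C $ i $ j * K $ i $ j
      - (if i = j then lambda_min C * (d $ i)\<^sup>2 else 0))"
    by (intro sum.cong) (auto simp: A_def K_def mat_def R(2) algebra_simps power2_eq_square)
  also have "\<dots> = (\<Sum>i\<in>UNIV. \<Sum>j\<in>UNIV. C $ i $ j * K $ i $ j)
      - lambda_min C * (\<Sum>i\<in>UNIV. (d $ i)\<^sup>2)"
    by (simp add: sum_subtractf sum_distrib_left)
  finally show ?thesis by (simp add: K_def)
qed

section \<open>The entrywise bound on the inverse\<close>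

theorem lemma3:
  fixes C R D :: "real^'n^'n" and lam \<alpha> :: real
  assumes "correlation_mat C" and "pos_def_mat C"
    and "0 \<le> lam" and "\<alpha> < 1"
    and "coordinatewise_minimizer pos_def_unit_diag pos_diag (objective C lam \<alpha>) R D"
  shows "norm_max (matrix_inv (D ** R ** D) - C)
    \<le> (lam * real CARD('n) + \<bar>\<alpha>\<bar>) * (real CARD('n))^2 / ((1 - \<alpha>) * lambda_min C)"
proof -
  define p where "p = real CARD('n)"
  define m where "m = lambda_min C"
  define d :: "real^'n" where "d = (\<chi> i. D $ i $ i)"
  define Q where "Q = matrix_inv R"
  define G where "G i j = Q $ i $ j - d $ i * C $ i $ j * d $ j" for i j
  define M where "M = lam * p + \<bar>\<alpha>\<bar>"
  have R: "R \<in> pos_def_unit_diag" and D: "D \<in> pos_diag"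
    and minD: "\<And>D'. D' \<in> pos_diag \<Longrightarrow> objective C lam \<alpha> R D \<le> objective C lam \<alpha> R D'"
    and minR: "\<And>R'. R' \<in> pos_def_unit_diag \<Longrightarrow> objective C lam \<alpha> R D \<le> objective C lam \<alpha> R' D"
    using assms(5) by (auto simp: coordinatewise_minimizer_def)
  have pdR: "pos_def_mat R" and diagR: "\<And>i. R $ i $ i = 1"
    using R by (auto simp: pos_def_unit_diag_def)
  have symC: "transpose C = C" and trR: "transpose R = R"
    using assms(2) pdR by (auto simp: pos_def_mat_def)
  have symR: "R $ i $ j = R $ j $ i" for i j
    by (rule symmetric_entry[OF trR])
  have psdR: "pos_semidef_mat R" and psdC: "pos_semidef_mat C"
    using pos_def_imp_pos_semidef assms(2) pdR by auto
  have R1: "\<bar>R $ i $ j\<bar> \<le> 1" for i j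
    using correlation_entry_le_1[OF psdR diagR] .
  have C1: "\<bar>C $ i $ j\<bar> \<le> 1" for i j
    using correlation_entry_le_1[OF psdC] assms(1) by (auto simp: correlation_mat_def)
  have dpos: "0 < d $ i" for i using D by (simp add: d_def pos_diag_def)
  have m: "0 < m" using lambda_min_pos[OF assms(2)] by (simp add: m_def)
  have p: "1 \<le> p" by (simp add: p_def Suc_le_eq)

  obtain B where B: "R ** B = mat 1"
    using pos_def_invertible[OF pdR] by (auto simp: invertible_def)
  then have RQ: "R ** Q = mat 1" using matrix_inv_eqI[OF B] by (simp add: Q_def)
  then have QR: "Q ** R = mat 1" by (simp add: matrix_left_right_inverse)
  have "R ** transpose Q = mat 1"
    by (metis QR matrix_transpose_mul trR transpose_mat)
  then have symQ: "transpose Q = Q"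
    using matrix_inv_eqI by (metis Q_def)

  have statD: "d $ k * (\<Sum>j\<in>UNIV. C $ k $ j * R $ k $ j * d $ j) = 1 - \<alpha>" for k
    using minimizer_in_D_stationary[OF symC trR D minD, of k] by (simp add: d_def)
  have off: "\<bar>G i j\<bar> \<le> lam" if "i \<noteq> j" for i j
    using minimizer_in_R_stationary[OF symC R D assms(3) minR RQ symQ that]
    by (simp add: G_def d_def)

  \<comment> \<open>The product \<open>Q ** R\<close> contributes 1 and stationarity in
    \<open>D\<close> subtracts \<open>1 - \<alpha>\<close>.\<close>
  have GR: "(\<Sum>j\<in>UNIV. G k j * R $ j $ k) = \<alpha>" for k
  proof -
    have "(\<Sum>j\<in>UNIV. G k j * R $ j $ k) = (Q ** R) $ k $ k
        - d $ k * (\<Sum>j\<in>UNIV. C $ k $ j * R $ k $ j * d $ j)"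
      by (simp add: G_def matrix_matrix_mult_def sum_subtractf sum_distrib_left symR[of k]
          algebra_simps)
    then show ?thesis by (simp add: QR statD mat_def)
  qed
  \<comment> \<open>As \<open>R $ k $ k = 1\<close>, the identity \<open>GR\<close> can be solved
    for \<open>G k k\<close>; the \<open>p - 1\<close> other terms are at most \<open>lam\<close>
    each, rounded up to \<open>lam * p\<close>.\<close>
  have diag: "\<bar>G k k\<bar> \<le> M" for k
  proof -
    have "G k k + (\<Sum>j\<in>UNIV - {k}. G k j * R $ j $ k) = \<alpha>"
      using GR[of k] by (simp add: sum.remove[of UNIV k] diagR)
    moreover have "\<bar>\<Sum>j\<in>UNIV - {k}. G k j * R $ j $ k\<bar> \<le> (\<Sum>j\<in>UNIV - {k}. lam)"
    proof (rule order_trans[OF sum_abs], rule sum_mono)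
      fix j assume "j \<in> UNIV - {k}"
      then have "\<bar>G k j\<bar> * \<bar>R $ j $ k\<bar> \<le> lam * 1"
        using off R1 assms(3) by (intro mult_mono) auto
      then show "\<bar>G k j * R $ j $ k\<bar> \<le> lam" by (simp add: abs_mult)
    qed
    moreover have "(\<Sum>j\<in>UNIV - {k}. lam) \<le> lam * p"
      using sum_mono2[of UNIV "UNIV - {k}" "\<lambda>_. lam"] assms(3) by (simp add: p_def mult.commute)
    ultimately show ?thesis unfolding M_def by linarith
  qed
  have "lam \<le> M"
    using mult_left_mono[OF p assms(3)] by (simp add: M_def)
  with off diag have GM: "\<bar>G i j\<bar> \<le> M" for i j
    by (cases "i = j") (auto intro: order_trans)

  define S where "S = (\<Sum>i\<in>UNIV. (d $ i)\<^sup>2)"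
  \<comment> \<open>The right-hand side is the sum of \<open>statD\<close> over all indices.\<close>
  have "m * S \<le> (\<Sum>i\<in>UNIV. d $ i * (\<Sum>j\<in>UNIV. C $ i $ j * R $ i $ j * d $ j))"
    using hadamard_lower_bound[OF assms(2) psdR diagR, of d]
    by (simp add: m_def S_def sum_distrib_left mult_ac)
  then have mS: "m * S \<le> p * (1 - \<alpha>)" by (simp add: statD p_def)
  \<comment> \<open>Square \<open>1 - \<alpha> \<le> d $ k * (\<Sum>j\<in>UNIV. d $ j)\<close>,
    bound the squared sum by \<open>S * p\<close>, multiply by \<open>m\<close> to apply
    \<open>mS\<close>, and cancel one factor \<open>1 - \<alpha>\<close>.\<close>
  have dk: "m * (1 - \<alpha>) / p\<^sup>2 \<le> (d $ k)\<^sup>2" for k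
  proof -
    have "(\<Sum>j\<in>UNIV. C $ k $ j * R $ k $ j * d $ j) \<le> (\<Sum>j\<in>UNIV. d $ j)"
    proof (rule sum_mono)
      fix j
      have "\<bar>C $ k $ j\<bar> * \<bar>R $ k $ j\<bar> \<le> 1 * 1" using C1 R1 by (intro mult_mono) auto
      then have "C $ k $ j * R $ k $ j \<le> 1" by (simp add: abs_mult[symmetric])
      then show "C $ k $ j * R $ k $ j * d $ j \<le> d $ j"
        using mult_right_mono[of _ 1 "d $ j"] dpos[of j] by fastforce
    qed
    from mult_left_mono[OF this, of "d $ k"] have "1 - \<alpha> \<le> d $ k * (\<Sum>j\<in>UNIV. d $ j)"
      using statD[of k] dpos[of k] by simp
    from power_mono[OF this, of 2]
    have "(1 - \<alpha>)\<^sup>2 \<le> (d $ k)\<^sup>2 * (\<Sum>j\<in>UNIV. d $ j)\<^sup>2"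
      using assms(4) by (simp add: power_mult_distrib)
    also have "\<dots> \<le> (d $ k)\<^sup>2 * (S * p)"
      using sum_squared_le_sum_of_squares[of "\<lambda>j. d $ j" UNIV]
      by (intro mult_left_mono) (auto simp: S_def p_def)
    finally have "m * (1 - \<alpha>)\<^sup>2 \<le> (d $ k)\<^sup>2 * p * (m * S)"
      using mult_left_mono[of _ _ m] m by (fastforce simp: mult_ac)
    also have "\<dots> \<le> (d $ k)\<^sup>2 * p * (p * (1 - \<alpha>))"
      using mS p by (intro mult_left_mono) auto
    finally have "(1 - \<alpha>) * (m * (1 - \<alpha>)) \<le> (1 - \<alpha>) * ((d $ k)\<^sup>2 * p\<^sup>2)"
      by (simp add: power2_eq_square mult_ac)
    then have "m * (1 - \<alpha>) \<le> (d $ k)\<^sup>2 * p\<^sup>2" using assms(4) by simp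
    then show ?thesis using p by (simp add: field_simps)
  qed
  \<comment> \<open>Multiplying \<open>dk\<close> for \<open>i\<close> and for \<open>j\<close>
    gives the square of this inequality, so no square root of the bound appears.\<close>
  have dd: "m * (1 - \<alpha>) / p\<^sup>2 \<le> d $ i * d $ j" for i j
  proof (rule power2_le_imp_le)
    show "(m * (1 - \<alpha>) / p\<^sup>2)\<^sup>2 \<le> (d $ i * d $ j)\<^sup>2"
      using mult_mono[OF dk[of i] dk[of j]] m assms(4)
      by (simp add: power2_eq_square[of "m * (1 - \<alpha>) / p\<^sup>2"] power_mult_distrib)
    show "0 \<le> d $ i * d $ j" using dpos by (simp add: less_imp_le)
  qed

  \<comment> \<open>The entries of \<open>D\<^sup>-\<^sup>1 Q D\<^sup>-\<^sup>1\<close>, the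
    candidate for the inverse of \<open>D ** R ** D\<close>.\<close>
  define X :: "real^'n^'n" where "X = (\<chi> i j. Q $ i $ j / (d $ i * d $ j))"
  have "(D ** R ** D) ** X = mat 1"
  proof -
    have "((D ** R ** D) ** X) $ i $ j = mat 1 $ i $ j" for i j
    proof -
      have "((D ** R ** D) ** X) $ i $ j
          = (\<Sum>k\<in>UNIV. d $ i * R $ i $ k * d $ k * (Q $ k $ j / (d $ k * d $ j)))"
        by (subst matrix_matrix_mult_def)
          (simp add: X_def d_def pos_diag_mult_left[OF D] pos_diag_mult_right[OF D])
      also have "\<dots> = (\<Sum>k\<in>UNIV. d $ i / d $ j * (R $ i $ k * Q $ k $ j))"
        using dpos by (intro sum.cong) (auto simp: field_simps less_imp_neq[THEN not_sym])
      also have "\<dots> = d $ i / d $ j * (R ** Q) $ i $ j"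
        by (simp add: matrix_matrix_mult_def sum_distrib_left)
      also have "\<dots> = mat 1 $ i $ j"
        using dpos[of i] by (auto simp: RQ mat_def)
      finally show ?thesis .
    qed
    then show ?thesis by (simp add: vec_eq_iff)
  qed
  then have inv: "matrix_inv (D ** R ** D) = X" by (rule matrix_inv_eqI)
  have bound: "\<bar>(X - C) $ i $ j\<bar> \<le> M * p\<^sup>2 / ((1 - \<alpha>) * m)" for i j
  proof -
    have "(X - C) $ i $ j = G i j / (d $ i * d $ j)"
      using dpos[of i] dpos[of j] by (simp add: X_def G_def field_simps)
    then have "\<bar>(X - C) $ i $ j\<bar> = \<bar>G i j\<bar> / (d $ i * d $ j)"
      using dpos[of i] dpos[of j] by (simp add: abs_mult)
    also have "\<dots> \<le> M / (m * (1 - \<alpha>) / p\<^sup>2)"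
      using GM[of i j] dd[of i j] m assms(4) p by (intro frac_le) (auto intro!: divide_pos_pos)
    also have "\<dots> = M * p\<^sup>2 / ((1 - \<alpha>) * m)" by (simp add: mult.commute)
    finally show ?thesis .
  qed
  have "finite {\<bar>(X - C) $ i $ j\<bar> | i j. True}"
    using finite_image_set2[of "\<lambda>_. True" "\<lambda>_. True" "\<lambda>i j. \<bar>(X - C) $ i $ j\<bar>"] by simp
  then have "norm_max (X - C) \<le> M * p\<^sup>2 / ((1 - \<alpha>) * m)"
    unfolding norm_max_def using bound by (subst Max_le_iff) auto
  then show ?thesis by (simp add: inv M_def p_def m_def)
qed

end
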